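(* Let $p$ be a propositional variable. The formula $\top\rhd\neg p$ has no fixed point in $\mathbf{IL}^-(\mathbf{J1},\mathbf{J4}_+,\mathbf{J5})$. That is, for any formula $A$ with $v(A)=\emptyset$, $$\mathbf{IL}^-(\mathbf{J1},\mathbf{J4}_+,\mathbf{J5}) \nvdash A \leftrightarrow (\top\rhd\neg A).$$
   Context: Formulas are generated by $A ::= \bot \mid p \mid A \to A \mid \Box A \mid A \rhd A$, where $p$ ranges over a countably infinite set of propositional variables. The symbols $\neg,\land,\lor,\leftrightarrow,\top,\Diamond$ (with $\Diamond A := \neg\Box\neg A$) are the usual abbreviations. $\neg,\Box,\Diamond$ bind most strongly. $v(A)$ is the set of propositional variables contained in $A$. The logic $\mathbf{IL}^-$ has as axioms all instances of: $\mathbf{L1}$: all tautologies in this language; $\mathbf{L2}$: $\Box(A\to B)\to(\Box A\to\Box B)$; $\mathbf{L3}$: $\Box(\Box A\to A)\to\Box A$; $\mathbf{J3}$: $((A\rhd C)\land(B\rhd C))\to((A\lor B)\rhd C)$; $\mathbf{J6}$: $\Box A\leftrightarrow((\neg A)\rhd\bot)$. Its inference rules are Modus Ponens, Necessitation (from $A$ infer $\Box A$), $\mathbf{R1}$ (from $A\to B$ infer $(C\rhd A)\to(C\rhd B)$) and $\mathbf{R2}$ (from $A\to B$ infer $(B\rhd C)\to(A\rhd C)$). $\mathbf{IL}^-(\Sigma_1,\ldots,\Sigma_n)$ is the logic obtained from $\mathbf{IL}^-$ by adding the schemata $\Sigma_1,\ldots,\Sigma_n$ as axiom schemata (with the same rules).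 $\mathbf{J1}$ is the schema $\Box(A\to B)\to(A\rhd B)$; $\mathbf{J4}_+$ is the schema $\Box(A\to B)\to((C\rhd A)\to(C\rhd B))$; $\mathbf{J5}$ is the schema $\Diamond A\rhd A$. $L\nvdash A$ means that $A$ is not a theorem of $L$. *)

theory Defs
  imports Main
begin

datatype form =
    Falsum  ("\<^bold>\<bottom>")
  | Var nat
  | Imp form form  (infixr "\<^bold>\<rightarrow>" 55)
  | Box form  ("\<box> _" [80] 80)
  | Rhd form form  (infix "\<rhd>" 60)

abbreviation Neg :: "form \<Rightarrow> form"  ("\<^bold>\<not> _" [80] 80)
  where "\<^bold>\<not> A \<equiv> A \<^bold>\<rightarrow> \<^bold>\<bottom>"

abbreviation Verum :: form  ("\<^bold>\<top>")
  where "\<^bold>\<top> \<equiv> \<^bold>\<not> \<^bold>\<bottom>"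

abbreviation Disj :: "form \<Rightarrow> form \<Rightarrow> form"  (infixr "\<^bold>\<or>" 65)
  where "A \<^bold>\<or> B \<equiv> (\<^bold>\<not> A) \<^bold>\<rightarrow> B"

abbreviation Conj :: "form \<Rightarrow> form \<Rightarrow> form"  (infixr "\<^bold>\<and>" 70)
  where "A \<^bold>\<and> B \<equiv> \<^bold>\<not> (A \<^bold>\<rightarrow> \<^bold>\<not> B)"

abbreviation Iff :: "form \<Rightarrow> form \<Rightarrow> form"  (infix "\<^bold>\<leftrightarrow>" 54)
  where "A \<^bold>\<leftrightarrow> B \<equiv> (A \<^bold>\<rightarrow> B) \<^bold>\<and> (B \<^bold>\<rightarrow> A)"

abbreviation Dia :: "form \<Rightarrow> form"  ("\<diamond> _" [80] 80)
  where "\<diamond> A \<equiv> \<^bold>\<not> \<box> (\<^bold>\<not> A)"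

primrec vars :: "form \<Rightarrow> nat set" where
  "vars \<^bold>\<bottom> = {}"
| "vars (Var q) = {q}"
| "vars (A \<^bold>\<rightarrow> B) = vars A \<union> vars B"
| "vars (\<box> A) = vars A"
| "vars (A \<rhd> B) = vars A \<union> vars B"

primrec subst_var :: "nat \<Rightarrow> form \<Rightarrow> form \<Rightarrow> form" where
  "subst_var p C \<^bold>\<bottom> = \<^bold>\<bottom>"
| "subst_var p C (Var q) = (if q = p then C else Var q)"
| "subst_var p C (A \<^bold>\<rightarrow> B) = subst_var p C A \<^bold>\<rightarrow> subst_var p C B"
| "subst_var p C (\<box> A) = \<box> (subst_var p C A)"
| "subst_var p C (A \<rhd> B) = subst_var p C A \<rhd> subst_var p C B"

text \<open>Tautologies in the full modal language: formulas true under every Boolean valuation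
  of the variables and of the subformulas whose main connective is \<open>\<box>\<close> or \<open>\<rhd>\<close>,
  which are treated as atoms.\<close>

primrec truth :: "(form \<Rightarrow> bool) \<Rightarrow> form \<Rightarrow> bool" where
  "truth v \<^bold>\<bottom> \<longleftrightarrow> False"
| "truth v (Var q) \<longleftrightarrow> v (Var q)"
| "truth v (A \<^bold>\<rightarrow> B) \<longleftrightarrow> (truth v A \<longrightarrow> truth v B)"
| "truth v (\<box> A) \<longleftrightarrow> v (\<box> A)"
| "truth v (A \<rhd> B) \<longleftrightarrow> v (A \<rhd> B)"

definition tautology :: "form \<Rightarrow> bool" where
  "tautology A \<longleftrightarrow> (\<forall>v. truth v A)"

text \<open>An axiom schema is represented by the set of all its instances. \<open>IL_minus \<Sigma>\<close> is the
  logic \<open>IL\<^sup>-\<close> with the additional axioms \<open>\<Sigma>\<close>; several schemata are added by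
  taking their union.\<close>

inductive IL_minus :: "form set \<Rightarrow> form \<Rightarrow> bool" for \<Sigma> :: "form set" where
  L1: "tautology A \<Longrightarrow> IL_minus \<Sigma> A"
| L2: "IL_minus \<Sigma> (\<box> (A \<^bold>\<rightarrow> B) \<^bold>\<rightarrow> (\<box> A \<^bold>\<rightarrow> \<box> B))"
| L3: "IL_minus \<Sigma> (\<box> (\<box> A \<^bold>\<rightarrow> A) \<^bold>\<rightarrow> \<box> A)"
| J3: "IL_minus \<Sigma> (((A \<rhd> C) \<^bold>\<and> (B \<rhd> C)) \<^bold>\<rightarrow> ((A \<^bold>\<or> B) \<rhd> C))"
| J6: "IL_minus \<Sigma> (\<box> A \<^bold>\<leftrightarrow> ((\<^bold>\<not> A) \<rhd> \<^bold>\<bottom>))"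
| Ax: "A \<in> \<Sigma> \<Longrightarrow> IL_minus \<Sigma> A"
| MP: "IL_minus \<Sigma> (A \<^bold>\<rightarrow> B) \<Longrightarrow> IL_minus \<Sigma> A \<Longrightarrow> IL_minus \<Sigma> B"
| Nec: "IL_minus \<Sigma> A \<Longrightarrow> IL_minus \<Sigma> (\<box> A)"
| R1: "IL_minus \<Sigma> (A \<^bold>\<rightarrow> B) \<Longrightarrow> IL_minus \<Sigma> ((C \<rhd> A) \<^bold>\<rightarrow> (C \<rhd> B))"
| R2: "IL_minus \<Sigma> (A \<^bold>\<rightarrow> B) \<Longrightarrow> IL_minus \<Sigma> ((B \<rhd> C) \<^bold>\<rightarrow> (A \<rhd> C))"

definition schema_J1 :: "form set" where
  "schema_J1 = {\<box> (A \<^bold>\<rightarrow> B) \<^bold>\<rightarrow> (A \<rhd> B) | A B. True}"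

definition schema_J4_plus :: "form set" where
  "schema_J4_plus = {\<box> (A \<^bold>\<rightarrow> B) \<^bold>\<rightarrow> ((C \<rhd> A) \<^bold>\<rightarrow> (C \<rhd> B)) | A B C. True}"

definition schema_J5 :: "form set" where
  "schema_J5 = {(\<diamond> A) \<rhd> A | A. True}"

definition is_fixed_point :: "form set \<Rightarrow> nat \<Rightarrow> form \<Rightarrow> form \<Rightarrow> bool" where
  "is_fixed_point \<Sigma> p F A \<longleftrightarrow>
     vars A \<subseteq> vars F - {p} \<and> IL_minus \<Sigma> (A \<^bold>\<leftrightarrow> subst_var p A F)"

end

theory Submission
  imports Defs
begin

text \<open>The logic is sound for the Veltman-style model on \<open>\<nat>\<close> where \<open>x\<close> sees all \<open>y < x\<close> and
  \<open>y S\<^sub>x z\<close> holds iff \<open>z \<le> y\<close> or \<open>z = x - 1\<close>.  Evaluating \<open>\<top> \<rhd> \<not>A\<close> at \<open>x > 0\<close>, the world \<open>y = 0\<close> reaches only \<open>0\<close> and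
  \<open>x - 1\<close>; hence a fixed point, being true at \<open>0\<close>, would have to be true at \<open>x\<close> iff it is
  false at \<open>x - 1\<close>, and would alternate forever.  But if all variables are false everywhere,
  then every formula is eventually constant along \<open>\<nat>\<close>.\<close>

text \<open>In the last clause \<open>x - 1\<close> is read only under some \<open>y < x\<close>, so
  truncation at 0 is harmless.\<close>

primrec sat :: "form \<Rightarrow> nat \<Rightarrow> bool" where
  "sat \<^bold>\<bottom> x \<longleftrightarrow> False"
| "sat (Var q) x \<longleftrightarrow> False"
| "sat (A \<^bold>\<rightarrow> B) x \<longleftrightarrow> (sat A x \<longrightarrow> sat B x)"
| "sat (\<box> A) x \<longleftrightarrow> (\<forall>y<x. sat A y)"
| "sat (A \<rhd> B) x \<longleftrightarrow> (\<forall>y<x. sat A y \<longrightarrow> (\<exists>z\<le>y. sat B z) \<or> sat B (x - 1))"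

text \<open>Every world induces a Boolean valuation with modal formulas as atoms, so tautologies
  hold there.\<close>

lemma truth_sat: "truth (\<lambda>B. sat B x) A \<longleftrightarrow> sat A x"
  by (induction A) auto

text \<open>Soundness of \<open>L3\<close>: strong induction works because a world sees only smaller
  numbers.\<close>

lemma sat_Loeb:
  assumes "\<forall>y<x. (\<forall>z<y. sat A z) \<longrightarrow> sat A y" and "y < x"
  shows "sat A y"
  using assms(2)
proof (induction y rule: less_induct)
  case (less y)
  then have "\<forall>z<y. sat A z" using less_trans by blast
  with assms(1) \<open>y < x\<close> show ?case by blast
qed

lemma soundness:
  assumes "IL_minus (schema_J1 \<union> schema_J4_plus \<union> schema_J5) A"
  shows "sat A x"
  using assms
proof (induction arbitrary: x rule: IL_minus.induct)
  case (L1 A)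
  then show ?case by (metis tautology_def truth_sat)
next
  case (L3 A)
  show ?case by (simp, blast intro: sat_Loeb)
next
  case (Ax A)
  then show ?case
  proof (elim UnE)
    assume "A \<in> schema_J1"
    then show ?thesis unfolding schema_J1_def by (clarsimp, blast)
  next
    assume "A \<in> schema_J4_plus"
    then obtain B C D where A: "A = \<box> (B \<^bold>\<rightarrow> C) \<^bold>\<rightarrow> ((D \<rhd> B) \<^bold>\<rightarrow> (D \<rhd> C))"
      by (auto simp: schema_J4_plus_def)
    have "sat (D \<rhd> C) x" if BC: "\<forall>y<x. sat B y \<longrightarrow> sat C y" and DB: "sat (D \<rhd> B) x"
      unfolding sat.simps
    proof (intro allI impI)
      fix y assume "y < x" "sat D y"
      with DB have "(\<exists>z\<le>y. sat B z) \<or> sat B (x - 1)" by auto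
      moreover have "x - 1 < x" "\<And>z. z \<le> y \<Longrightarrow> z < x" using \<open>y < x\<close> by auto
      ultimately show "(\<exists>z\<le>y. sat C z) \<or> sat C (x - 1)" using BC by blast
    qed
    then show ?thesis unfolding A by simp
  next
    assume "A \<in> schema_J5"
    \<comment> \<open>A world \<open>z < y\<close> witnessing the diamond at \<open>y\<close> also
      satisfies \<open>z \<le> y\<close>.\<close>
    then show ?thesis unfolding schema_J5_def by (clarsimp, meson less_imp_le)
  qed
next
  case (R1 A B C)
  then have "sat B y" if "sat A y" for y using that by simp
  then show ?case by (simp, blast)
next
  case (R2 A B C)
  then have "sat B y" if "sat A y" for y using that by simp
  then show ?case by simp
next
  case (J3 A C B)
  show ?case by (simp, blast)
qed simp_all

lemma sat_eventually_constant: "\<exists>N b. \<forall>x\<ge>N. sat A x \<longleftrightarrow> b"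
proof (induction A)
  case (Imp A B)
  then obtain M a N b where "\<forall>x\<ge>M. sat A x \<longleftrightarrow> a" "\<forall>x\<ge>N. sat B x \<longleftrightarrow> b" by blast
  then have "\<forall>x\<ge>max M N. sat (A \<^bold>\<rightarrow> B) x \<longleftrightarrow> (a \<longrightarrow> b)" by simp
  then show ?case by blast
next
  case (Box A)
  show ?case
  proof (cases "\<forall>y. sat A y")
    case False
    then obtain y where "\<not> sat A y" by blast
    then have "\<forall>x\<ge>Suc y. sat (\<box> A) x \<longleftrightarrow> False" by (auto simp: Suc_le_eq)
    then show ?thesis by blast
  qed auto
next
  case (Rhd A B)
  then obtain N b where N: "\<forall>x\<ge>N. sat B x \<longleftrightarrow> b" by blast
  show ?case
  \<comment> \<open>For \<open>x > N\<close> the disjunct \<open>sat B (x - 1)\<close> has the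
    constant value \<open>b\<close>. If \<open>b\<close> is false, what remains is a condition on
    all \<open>y < x\<close>, which one counterexample \<open>y\<close> refutes for every larger
    \<open>x\<close>.\<close>
  proof (cases "b \<or> (\<forall>y. sat A y \<longrightarrow> (\<exists>z\<le>y. sat B z))")
    case True
    then have "\<forall>x\<ge>Suc N. sat (A \<rhd> B) x \<longleftrightarrow> True" using N by auto
    then show ?thesis by blast
  next
    case False
    then obtain y where "\<not> b" "sat A y" "\<forall>z\<le>y. \<not> sat B z" by blast
    then have "\<not> sat (A \<rhd> B) x" if "x \<ge> Suc (max N y)" for x
      using N that by (auto intro!: exI[of _ y])
    then show ?thesis by blast
  qed
qed auto

lemma fixed_point_alternates:
  assumes "\<And>x. sat A x \<longleftrightarrow> sat (\<^bold>\<top> \<rhd> \<^bold>\<not> A) x"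
  shows "sat A (Suc x) \<longleftrightarrow> \<not> sat A x"
proof -
  \<comment> \<open>Vacuous, as 0 sees no world. So \<open>y = 0\<close> in the next step leaves
    only the disjunct at \<open>Suc x - 1 = x\<close>.\<close>
  have "sat A 0" using assms[of 0] by simp
  then show ?thesis using assms[of "Suc x"] by auto
qed

lemma no_fixed_point:
  "\<not> IL_minus (schema_J1 \<union> schema_J4_plus \<union> schema_J5) (A \<^bold>\<leftrightarrow> (\<^bold>\<top> \<rhd> \<^bold>\<not> A))"
proof
  assume "IL_minus (schema_J1 \<union> schema_J4_plus \<union> schema_J5) (A \<^bold>\<leftrightarrow> (\<^bold>\<top> \<rhd> \<^bold>\<not> A))"
  from soundness[OF this] have "sat A x \<longleftrightarrow> sat (\<^bold>\<top> \<rhd> \<^bold>\<not> A) x" for x by auto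
  then have alternates: "sat A (Suc x) \<longleftrightarrow> \<not> sat A x" for x by (rule fixed_point_alternates)
  obtain N b where "\<forall>x\<ge>N. sat A x \<longleftrightarrow> b" using sat_eventually_constant by blast
  then have "sat A N \<longleftrightarrow> b" "sat A (Suc N) \<longleftrightarrow> b" by simp_all
  with alternates[of N] show False by simp
qed

theorem theorem6p5:
  fixes p :: nat
  shows "(\<nexists>A. is_fixed_point (schema_J1 \<union> schema_J4_plus \<union> schema_J5) p (\<^bold>\<top> \<rhd> \<^bold>\<not> Var p) A)
       \<and> (\<forall>A. vars A = {} \<longrightarrow> \<not> IL_minus (schema_J1 \<union> schema_J4_plus \<union> schema_J5) (A \<^bold>\<leftrightarrow> (\<^bold>\<top> \<rhd> \<^bold>\<not> A)))"
  by (simp add: is_fixed_point_def no_fixed_point)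

end
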